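(* Suppose $\mathcal{X}:=\{x\in\mathbb{R}^p:Ax\ge a\}$ is nonempty, for some $A\in\mathbb{R}^{m\times p}$ and $a\in\mathbb{R}^m$. Let $B\in\mathbb{R}^{K\times p}$ and $b\in\mathbb{R}^K$. Then the constraint $$Bx+b\in\Delta_K\quad\forall x\in\mathcal{X}$$ can be rewritten as the following group of constraints by introducing new decision variables $y_k\in\mathbb{R}^m$ ($k=1,\dots,K$) and $z,u\in\mathbb{R}^m$; that is, $(B,b)$ satisfies the constraint if and only if there exist $y_1,\dots,y_K,z,u\in\mathbb{R}^m$ with $$\begin{cases}a^Ty_k\ge-b_k & \forall k=1,\dots,K\\ A^Ty_k=B_k & \forall k=1,\dots,K\\ a^Tz\ge1-\mathbf{1}^Tb\\ A^Tz=B^T\mathbf{1}\\ a^Tu\ge-1+\mathbf{1}^Tb\\ A^Tu=-B^T\mathbf{1}\\ y_k,z,u\ge0 & \forall k=1,\dots,K.\end{cases}$$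
   Context: $\Delta_K:=\{p\in\mathbb{R}^K:\sum_{k=1}^Kp_k=1,\ p\ge0\}$. $B_k\in\mathbb{R}^p$ denotes the $k$-th row of $B$, written as a column vector; $\mathbf{1}\in\mathbb{R}^K$ is the all-ones vector; vector inequalities are componentwise. *)

theory Defs
  imports "HOL-Analysis.Analysis"
begin

(* On real ^ 'n the order is componentwise and 1 is the all-ones vector. *)

definition prob_simplex :: "(real ^ 'k) set" where
  "prob_simplex = {p. (\<Sum>k\<in>UNIV. p $ k) = 1 \<and> p \<ge> 0}"

end

theory Submission
  imports Defs
begin

text \<open>
  Membership in the simplex amounts to \<open>K + 2\<close> affine inequalities in \<open>x\<close>, the equation
  being split into two. By the affine form of Farkas' lemma, each of them is valid on the nonempty
  polyhedron iff it is a nonnegative combination of the defining inequalities and the trivial one;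
  the multipliers are the new variables.
\<close>

text \<open>A finitely generated convex cone is closed, so a point \<open>w\<close> outside it can
  be strictly separated from it. Since the cone contains 0 and is closed under nonnegative scaling,
  the separating normal is nonnegative on every generator yet negative on \<open>w\<close>, against
  the assumption.\<close>

lemma farkas_finite_cone:
  fixes g :: "'i::finite \<Rightarrow> 'a::euclidean_space"
  assumes "\<And>v. (\<And>i. 0 \<le> g i \<bullet> v) \<Longrightarrow> 0 \<le> w \<bullet> v"
  shows "\<exists>c. (\<forall>i. 0 \<le> c i) \<and> w = (\<Sum>i\<in>UNIV. c i *\<^sub>R g i)"
proof -
  define C where "C = convex_cone hull (range g)"
  define D where "D = {x. \<exists>c. (\<forall>i. 0 \<le> c i) \<and> x = (\<Sum>i\<in>UNIV. c i *\<^sub>R g i)}"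
  have gC: "g i \<in> C" for i
    unfolding C_def by (simp add: hull_inc)
  have "w \<in> C"
  proof (rule ccontr)
    assume "w \<notin> C"
    moreover have "convex C" "closed C"
      unfolding C_def by (simp_all add: convex_convex_cone_hull closed_convex_cone_hull)
    ultimately obtain v \<beta> where w: "v \<bullet> w < \<beta>" and v: "\<And>x. x \<in> C \<Longrightarrow> \<beta> < v \<bullet> x"
      using separating_hyperplane_closed_point by metis
    have "\<beta> < 0"
      using v[of 0] by (simp add: C_def convex_cone_hull_contains_0)
    have "0 \<le> g i \<bullet> v" for i
    proof (rule ccontr)
      assume "\<not> 0 \<le> g i \<bullet> v"
      then have neg: "v \<bullet> g i < 0" by (simp add: inner_commute)
      \<comment> \<open>The factor is a quotient of two negative numbers, scaled so that
        \<open>v\<close> takes exactly the value \<beta> at this point of \<open>C\<close>; the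
        separation demands a value strictly above \<beta>.\<close>
      then have "(\<beta> / (v \<bullet> g i)) *\<^sub>R g i \<in> C"
        using gC[of i] \<open>\<beta> < 0\<close> unfolding C_def
        by (intro convex_cone_hull_mul) (auto simp: divide_nonpos_nonpos)
      from v[OF this] neg show False by simp
    qed
    then have "0 \<le> w \<bullet> v" by (rule assms)
    with w \<open>\<beta> < 0\<close> show False by (simp add: inner_commute)
  qed
  \<comment> \<open>Minimality of the hull turns membership in \<open>C\<close> into an explicit
    combination with one coefficient per index.\<close>
  moreover have "C \<subseteq> D"
    unfolding C_def
  proof (rule hull_minimal)
    show "range g \<subseteq> D"
    proof clarify
      fix i
      have "g i = (\<Sum>j\<in>UNIV. (if j = i then 1 else 0) *\<^sub>R g j)"
        by (simp add: if_distrib [where f = "\<lambda>r. r *\<^sub>R _"] cong: if_cong)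
      then show "g i \<in> D"
        unfolding D_def by (intro CollectI exI[of _ "\<lambda>j. if j = i then 1 else 0"]) auto
    qed
    show "convex_cone D"
      unfolding convex_cone_iff
    proof (intro conjI ballI allI impI)
      show "0 \<in> D"
        unfolding D_def by (intro CollectI exI[of _ "\<lambda>_. 0"]) auto
    next
      fix x y assume "x \<in> D" "y \<in> D"
      then obtain c d where "\<forall>i. 0 \<le> c i" "x = (\<Sum>i\<in>UNIV. c i *\<^sub>R g i)"
        "\<forall>i. 0 \<le> d i" "y = (\<Sum>i\<in>UNIV. d i *\<^sub>R g i)"
        unfolding D_def by blast
      then show "x + y \<in> D"
        unfolding D_def
        by (intro CollectI exI[of _ "\<lambda>i. c i + d i"])
          (auto simp: scaleR_add_left sum.distrib)
    next
      fix x and r :: real assume "x \<in> D" "0 \<le> r"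
      then obtain c where "\<forall>i. 0 \<le> c i" "x = (\<Sum>i\<in>UNIV. c i *\<^sub>R g i)"
        unfolding D_def by blast
      with \<open>0 \<le> r\<close> show "r *\<^sub>R x \<in> D"
        unfolding D_def
        by (intro CollectI exI[of _ "\<lambda>i. r * c i"]) (auto simp: scaleR_sum_right)
    qed
  qed
  ultimately show ?thesis unfolding D_def by blast
qed

lemma inner_matrix_vector_mult:
  fixes A :: "real ^ 'p ^ 'm"
  shows "(transpose A *v y) \<bullet> x = y \<bullet> (A *v x)"
  by (simp add: dot_lmul_matrix transpose_matrix_vector)

lemma inner_vec_nonneg:
  fixes x y :: "real ^ 'm"
  shows "0 \<le> x \<Longrightarrow> 0 \<le> y \<Longrightarrow> 0 \<le> x \<bullet> y"
  by (simp add: inner_vec_def less_eq_vec_def sum_nonneg)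

text \<open>From right to left, weighting the constraints by \<open>y\<close> bounds the form below.
  From left to right, homogenize with an extra coordinate \<open>t\<close> and apply the conic
  version in one dimension more.\<close>

lemma affine_farkas:
  fixes A :: "real ^ 'p ^ 'm"
  assumes nonempty: "{x. a \<le> A *v x} \<noteq> {}"
  shows "(\<forall>x\<in>{x. a \<le> A *v x}. 0 \<le> c \<bullet> x + d) \<longleftrightarrow>
    (\<exists>y. - d \<le> a \<bullet> y \<and> transpose A *v y = c \<and> 0 \<le> y)"
proof (intro iffI ballI)
  fix x assume "\<exists>y. - d \<le> a \<bullet> y \<and> transpose A *v y = c \<and> 0 \<le> y" and x: "x \<in> {x. a \<le> A *v x}"
  then obtain y where y: "- d \<le> a \<bullet> y" "transpose A *v y = c" "0 \<le> y" by blast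
  have "0 \<le> y \<bullet> (A *v x - a)"
    using x y(3) by (intro inner_vec_nonneg) auto
  then show "0 \<le> c \<bullet> x + d"
    using y inner_matrix_vector_mult[of A y x] by (simp add: inner_diff_right inner_commute)
next
  assume valid: "\<forall>x\<in>{x. a \<le> A *v x}. 0 \<le> c \<bullet> x + d"
  obtain x0 where x0: "a \<le> A *v x0" using nonempty by blast
  \<comment> \<open>A vector \<open>(x, t)\<close> is nonnegative on all generators iff
    \<open>t\<close> is nonnegative and \<open>A *v x\<close> dominates \<open>t\<close> times
    \<open>a\<close>. The generator at \<open>None\<close> stands for the trivial inequality 0 \<le>
    1; its multiplier will be the slack in the bound on \<open>a \<bullet> y\<close>.\<close>
  define g :: "'m option \<Rightarrow> (real ^ 'p) \<times> real"
    where "g = (\<lambda>j. case j of None \<Rightarrow> (0, 1) | Some i \<Rightarrow> (row i A, - (a $ i)))"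
  have "0 \<le> (c, d) \<bullet> v" if "\<And>j. 0 \<le> g j \<bullet> v" for v
  proof -
    obtain x t where v: "v = (x, t)" by fastforce
    have t: "0 \<le> t" using that[of None] by (simp add: g_def v)
    have rows: "t * a $ i \<le> (A *v x) $ i" for i
      using that[of "Some i"]
      by (simp add: g_def v matrix_vector_mul_component row_def vec_lambda_eta mult.commute)
    show ?thesis
    proof (cases "t = 0")
      \<comment> \<open>Dividing by \<open>t\<close> gives a point of the polyhedron, where validity
        applies.\<close>
      case False
      with t have "0 < t" by simp
      then have "a \<le> A *v ((1 / t) *\<^sub>R x)"
        using rows by (auto simp: less_eq_vec_def matrix_vector_mult_scaleR field_simps)
      then have "0 \<le> c \<bullet> ((1 / t) *\<^sub>R x) + d" using valid by blast
      with \<open>0 < t\<close> show ?thesis by (simp add: v field_simps)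
    next
      \<comment> \<open>Now \<open>x\<close> is a recession direction: moving from \<open>x0\<close>
        along it never leaves the polyhedron, so the form cannot decrease along it. This is where
        nonemptiness enters.\<close>
      case True
      show ?thesis
      proof (rule ccontr)
        assume "\<not> 0 \<le> (c, d) \<bullet> v"
        with True have neg: "c \<bullet> x < 0" by (simp add: v)
        \<comment> \<open>The step length at which the form \<open>c \<bullet> _ + d\<close> reaches
          -1 on the ray from \<open>x0\<close>.\<close>
        define s where "s = (c \<bullet> x0 + d + 1) / - (c \<bullet> x)"
        have "0 \<le> s"
          using neg valid x0 unfolding s_def by (intro divide_nonneg_pos) auto
        have "a \<le> A *v (x0 + s *\<^sub>R x)"
          using x0 rows True \<open>0 \<le> s\<close>
          by (auto simp: less_eq_vec_def matrix_vector_right_distrib matrix_vector_mult_scaleR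
              intro!: add_increasing2)
        then have "0 \<le> c \<bullet> (x0 + s *\<^sub>R x) + d" using valid by blast
        moreover have "s * (c \<bullet> x) = - (c \<bullet> x0 + d + 1)"
          using neg by (simp add: s_def field_simps)
        ultimately show False by (simp add: inner_add_right)
      qed
    qed
  qed
  then obtain r where r: "\<And>j. 0 \<le> r j" "(c, d) = (\<Sum>j\<in>UNIV. r j *\<^sub>R g j)"
    using farkas_finite_cone[of g "(c, d)"] by blast
  define y :: "real ^ 'm" where "y = (\<chi> i. r (Some i))"
  \<comment> \<open>The first component of this identity yields the equation for \<open>c\<close>,
    the second yields \<open>d\<close> as the slack minus \<open>a \<bullet> y\<close>.\<close>
  have cd: "(c, d) = r None *\<^sub>R g None + (\<Sum>i\<in>UNIV. r (Some i) *\<^sub>R g (Some i))"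
    unfolding r(2) by (simp add: UNIV_option_conv sum.reindex)
  have "c = (\<Sum>i\<in>UNIV. y $ i *\<^sub>R row i A)"
    using arg_cong[OF cd, of fst] by (simp add: g_def y_def fst_sum)
  also have "\<dots> = transpose A *v y"
    by (simp add: vec_eq_iff matrix_vector_mult_def transpose_def row_def mult.commute)
  finally have "transpose A *v y = c" by simp
  moreover have "d = r None - a \<bullet> y"
    using arg_cong[OF cd, of snd]
    by (simp add: g_def y_def snd_sum inner_vec_def sum_negf mult.commute)
  then have "- d \<le> a \<bullet> y" using r(1)[of None] by simp
  moreover have "0 \<le> y" using r(1) by (simp add: y_def less_eq_vec_def)
  ultimately show "\<exists>y. - d \<le> a \<bullet> y \<and> transpose A *v y = c \<and> 0 \<le> y" by blast
qed

lemma affine_mem_prob_simplex_iff: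
  fixes B :: "real ^ 'p ^ 'K"
  shows "B *v x + b \<in> prob_simplex \<longleftrightarrow>
    (\<forall>k. 0 \<le> row k B \<bullet> x + b $ k) \<and>
    0 \<le> (transpose B *v 1) \<bullet> x + (1 \<bullet> b - 1) \<and>
    0 \<le> (- (transpose B *v 1)) \<bullet> x + (1 - 1 \<bullet> b)"
proof -
  have "(\<Sum>k\<in>UNIV. (B *v x + b) $ k) = 1 \<bullet> (B *v x) + 1 \<bullet> b"
    by (simp add: inner_vec_def sum.distrib)
  then show ?thesis
    unfolding prob_simplex_def
    by (auto simp: less_eq_vec_def dot_lmul_matrix matrix_vector_mul_component
        row_def vec_lambda_eta)
qed

theorem proposition5:
  fixes A :: "real ^ 'p ^ 'm"
    and a :: "real ^ 'm"
    and B :: "real ^ 'p ^ 'K"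
    and b :: "real ^ 'K"
    and X :: "(real ^ 'p) set"
  assumes X_def: "X = {x. A *v x \<ge> a}"
    and X_nonempty: "X \<noteq> {}"
  shows "(\<forall>x\<in>X. B *v x + b \<in> prob_simplex) \<longleftrightarrow>
    (\<exists>(y :: 'K \<Rightarrow> real ^ 'm) (z :: real ^ 'm) (u :: real ^ 'm).
        (\<forall>k. a \<bullet> y k \<ge> - (b $ k)) \<and>
        (\<forall>k. transpose A *v y k = row k B) \<and>
        a \<bullet> z \<ge> 1 - 1 \<bullet> b \<and>
        transpose A *v z = transpose B *v 1 \<and>
        a \<bullet> u \<ge> - 1 + 1 \<bullet> b \<and>
        transpose A *v u = - (transpose B *v 1) \<and>
        (\<forall>k. y k \<ge> 0) \<and> z \<ge> 0 \<and> u \<ge> 0)"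
proof -
  note farkas = affine_farkas[OF X_nonempty[unfolded X_def], folded X_def]
  have "(\<forall>x\<in>X. B *v x + b \<in> prob_simplex) \<longleftrightarrow>
    (\<forall>k. \<forall>x\<in>X. 0 \<le> row k B \<bullet> x + b $ k) \<and>
    (\<forall>x\<in>X. 0 \<le> (transpose B *v 1) \<bullet> x + (1 \<bullet> b - 1)) \<and>
    (\<forall>x\<in>X. 0 \<le> (- (transpose B *v 1)) \<bullet> x + (1 - 1 \<bullet> b))"
    unfolding affine_mem_prob_simplex_iff by blast
  \<comment> \<open>Each inequality is valid on \<open>X\<close> separately, so each gets its own
    multiplier vector; choice over \<open>k\<close> gathers the row multipliers into one function
    \<open>y\<close>.\<close>
  also have "\<dots> \<longleftrightarrow>
    (\<exists>y. \<forall>k. - (b $ k) \<le> a \<bullet> y k \<and> transpose A *v y k = row k B \<and> 0 \<le> y k) \<and>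
    (\<exists>z. - (1 \<bullet> b - 1) \<le> a \<bullet> z \<and> transpose A *v z = transpose B *v 1 \<and> 0 \<le> z) \<and>
    (\<exists>u. - (1 - 1 \<bullet> b) \<le> a \<bullet> u \<and> transpose A *v u = - (transpose B *v 1) \<and> 0 \<le> u)"
    unfolding farkas choice_iff ..
  also have "- (1 \<bullet> b - 1) = 1 - 1 \<bullet> b" by simp
  also have "- (1 - 1 \<bullet> b) = - 1 + 1 \<bullet> b" by simp
  finally show ?thesis by blast
qed

end
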